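(* Consider a finite connected dissipative flow network $\mathcal{G}=(\mathcal{V},\mathcal{E})$ with differentiable dissipation functions $f_{ij}$, reference node $0\in\mathcal{V}$ whose potential is fixed at $\pi_0=c_{\mathrm{ref}}$, parameters $b=(b_{ij})_{(i,j)\in\mathcal{E}}$, cost coefficients $(c_i)_{i\in\mathcal{V}}$, and potential bounds $\underline{\pi}_i\le\overline{\pi}_i$, $i\in\mathcal{V}$. Let $\mathcal{V}'=\mathcal{V}\setminus\{0\}$, and for $x\in\mathbb{R}^{\mathcal{V}'}$ put $x_0=-\sum_{i\in\mathcal{V}'}x_i$. The maximum throughput problem is $$\min_{x,\phi,\pi}\ \sum_{i\in\mathcal{V}}c_ix_i\quad\text{s.t.}\quad\sum_{j\in\partial i}\phi_{ij}=x_i\ \forall i\in\mathcal{V},\quad \pi_i-\pi_j=f_{ij}(\phi_{ij})-b_{ij}\ \forall(i,j)\in\mathcal{E},\quad\underline{\pi}_i\le\pi_i\le\overline{\pi}_i\ \forall i\in\mathcal{V}.\quad(\mathrm{MT})$$ With $E$, $E^*$ as defined in the context, consider also the energy function formulation $$\min_{x,\pi}\ \sum_{i\in\mathcal{V}}c_ix_i\quad\text{s.t.}\quad E(\pi,b)+E^*(x,b)-\pi^Tx\le0,\quad\underline{\pi}_i\le\pi_i\le\overline{\pi}_i\ \forall i\in\mathcal{V},\quad(\mathrm{EF})$$ and its two variants: (EF1), in which the right-hand side $0$ of the energy constraint is replaced by a small constant $\epsilon>0$; and (EF2), $$\min_{x,\pi}\ \sum_{i\in\mathcal{V}}c_ix_i+M\bigl(E(\pi,b)+E^*(x,b)-\pi^Tx\bigr)\quad\text{s.t.}\quad\underline{\pi}_i\le\pi_i\le\overline{\pi}_i\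 \forall i\in\mathcal{V},$$ with $M$ a large positive constant. In all of them $\pi_0=c_{\mathrm{ref}}$. Then: (i) (MT) and (EF) are exactly equivalent: a pair $(x,\pi)$ is feasible for (EF) if and only if there exists $\phi$ such that $(x,\phi,\pi)$ is feasible for (MT), and the objectives coincide. (ii) The expressions in (EF1) and (EF2), i.e. the function $E(\pi,b)+E^*(x,b)-\pi^Tx$ occurring in them, are twice differentiable. (iii) When $b$ is not an optimization variable, these expressions are biconvex in $\pi$ and $x$ (convex in $\pi$ for each fixed $x$ and convex in $x$ for each fixed $\pi$). When $b$ is also subject to optimization, the biconvexity is lost, but the twice differentiability remains.
   Context: A dissipative flow network consists of a finite connected undirected graph $\mathcal{G}=(\mathcal{V},\mathcal{E})$ in which each edge has a fixed nominal orientation $i\to j$, written $(i,j)\in\mathcal{E}$ (each edge appears in $\mathcal{E}$ once). Each edge carries a flow $\phi_{ij}\in\mathbb{R}$ with $\phi_{ji}=-\phi_{ij}$ and a parameter $b_{ij}\in\mathbb{R}$; each node carries a potential $\pi_i\in\mathbb{R}$. $\partial i$ is the set of neighbours of $i$. Each dissipation function $f_{ij}:\mathbb{R}\to\mathbb{R}$ is odd, differentiable and strictly monotonically increasing, hence invertible. Let $g_{ij}=f_{ij}^{-1}$ denote its inverse and, with $F_{ij}$ an anti-derivative of $f_{ij}$, let $G_{ij}(y)=y\,g_{ij}(y)-F_{ij}(g_{ij}(y))$, an anti-derivative of $g_{ij}$. With $\pi_0=c_{\mathrm{ref}}$ fixed and the remaining potentials $\pi\in\mathbb{R}^{\mathcal{V}'}$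 free, define $$E(\pi,b)=\sum_{(i,j)\in\mathcal{E}}G_{ij}(\pi_i-\pi_j+b_{ij}),\qquad E^*(x,b)=\sup_{\pi}\bigl[\pi^Tx-E(\pi,b)\bigr],\qquad\pi^Tx=\sum_{i\in\mathcal{V}'}\pi_ix_i.$$
   Formalization: Twice differentiability in (ii), (iii) is proved when no f_ij' vanishes; it fails otherwise (one edge, f(t)=t^3). Each f_ij is taken to be onto R, so that g_ij and E are defined everywhere. "Biconvexity is lost" means that it fails for some network. *)

theory Defs
  imports "HOL-Analysis.Analysis"
begin

text \<open>Nodes are the elements of a finite type \<open>'v\<close>. Vectors indexed by the non-reference nodes
  are elements of \<open>real ^ 'v\<close> whose coordinate at the reference node is never read. Likewise
  \<open>b\<close> is read only at pairs in \<open>edges N\<close>. Convexity and differentiability are unaffected by such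
  dummy coordinates, and a network with a single node is covered.\<close>

record 'v network =
  ref :: 'v
  cref :: real
  edges :: "('v \<times> 'v) set"
  diss :: "'v \<Rightarrow> 'v \<Rightarrow> real \<Rightarrow> real"
  adiss :: "'v \<Rightarrow> 'v \<Rightarrow> real \<Rightarrow> real"

text \<open>\<open>adiss\<close> is the chosen anti-derivative \<open>F\<close> of \<open>diss\<close>. Being invertible with inverse defined on
  all of the reals includes surjectivity, which strict monotonicity alone does not give.\<close>

definition dissipative_network :: "('v::finite) network \<Rightarrow> bool" where
  "dissipative_network N \<longleftrightarrow>
     (\<forall>i j. (i, j) \<in> edges N \<longrightarrow> (j, i) \<notin> edges N) \<and>
     (\<forall>i j. (i, j) \<in> (edges N \<union> (edges N)\<inverse>)\<^sup>*) \<and>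
     (\<forall>(i, j) \<in> edges N.
        (\<forall>t. diss N i j (- t) = - diss N i j t) \<and>
        (\<forall>t. diss N i j differentiable at t) \<and>
        strict_mono (diss N i j) \<and>
        bij (diss N i j) \<and>
        (\<forall>t. (adiss N i j has_real_derivative diss N i j t) (at t)))"

text \<open>Strict monotonicity allows \<open>f'\<close> to vanish at isolated points, as for \<open>f t = t ^ 3\<close>; there the
  inverse \<open>g\<close>, and hence the gradient of the energy, is not differentiable.\<close>

definition nondegenerate :: "('v::finite) network \<Rightarrow> bool" where
  "nondegenerate N \<longleftrightarrow> (\<forall>(i, j) \<in> edges N. \<forall>t. deriv (diss N i j) t \<noteq> 0)"

definition neighbours :: "('v::finite) network \<Rightarrow> 'v \<Rightarrow> 'v set" where
  "neighbours N i = {j. (i, j) \<in> edges N \<or> (j, i) \<in> edges N}"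

definition potential :: "('v::finite) network \<Rightarrow> real ^ 'v \<Rightarrow> 'v \<Rightarrow> real" where
  "potential N \<pi> i = (if i = ref N then cref N else \<pi> $ i)"

definition injection :: "('v::finite) network \<Rightarrow> real ^ 'v \<Rightarrow> 'v \<Rightarrow> real" where
  "injection N x i = (if i = ref N then - (\<Sum>j \<in> UNIV - {ref N}. x $ j) else x $ i)"

definition pairing :: "('v::finite) network \<Rightarrow> real ^ 'v \<Rightarrow> real ^ 'v \<Rightarrow> real" where
  "pairing N \<pi> x = (\<Sum>i \<in> UNIV - {ref N}. \<pi> $ i * x $ i)"

definition inv_diss :: "('v::finite) network \<Rightarrow> 'v \<Rightarrow> 'v \<Rightarrow> real \<Rightarrow> real" where
  "inv_diss N i j = inv (diss N i j)"

definition edge_energy :: "('v::finite) network \<Rightarrow> 'v \<Rightarrow> 'v \<Rightarrow> real \<Rightarrow> real" where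
  "edge_energy N i j y = y * inv_diss N i j y - adiss N i j (inv_diss N i j y)"

definition energy :: "('v::finite) network \<Rightarrow> real ^ 'v \<Rightarrow> real ^ ('v \<times> 'v) \<Rightarrow> real" where
  "energy N \<pi> b =
     (\<Sum>(i, j) \<in> edges N. edge_energy N i j (potential N \<pi> i - potential N \<pi> j + b $ (i, j)))"

text \<open>The supremum is taken in the reals; it is finite by \<open>bdd_above_energy_conj\<close> below.\<close>

definition energy_conj :: "('v::finite) network \<Rightarrow> real ^ 'v \<Rightarrow> real ^ ('v \<times> 'v) \<Rightarrow> real" where
  "energy_conj N x b = (SUP \<pi>. pairing N \<pi> x - energy N \<pi> b)"

definition energy_gap ::
  "('v::finite) network \<Rightarrow> real ^ 'v \<Rightarrow> real ^ 'v \<Rightarrow> real ^ ('v \<times> 'v) \<Rightarrow> real" where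
  "energy_gap N \<pi> x b = energy N \<pi> b + energy_conj N x b - pairing N \<pi> x"

definition within_bounds ::
  "('v::finite) network \<Rightarrow> ('v \<Rightarrow> real) \<Rightarrow> ('v \<Rightarrow> real) \<Rightarrow> real ^ 'v \<Rightarrow> bool" where
  "within_bounds N lb ub \<pi> \<longleftrightarrow> (\<forall>i. lb i \<le> potential N \<pi> i \<and> potential N \<pi> i \<le> ub i)"

definition MT_feasible ::
  "('v::finite) network \<Rightarrow> real ^ ('v \<times> 'v) \<Rightarrow> ('v \<Rightarrow> real) \<Rightarrow> ('v \<Rightarrow> real) \<Rightarrow>
   real ^ 'v \<Rightarrow> ('v \<Rightarrow> 'v \<Rightarrow> real) \<Rightarrow> real ^ 'v \<Rightarrow> bool" where
  "MT_feasible N b lb ub x \<phi> \<pi> \<longleftrightarrow>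
     (\<forall>(i, j) \<in> edges N. \<phi> j i = - \<phi> i j) \<and>
     (\<forall>i. (\<Sum>j \<in> neighbours N i. \<phi> i j) = injection N x i) \<and>
     (\<forall>(i, j) \<in> edges N.
        potential N \<pi> i - potential N \<pi> j = diss N i j (\<phi> i j) - b $ (i, j)) \<and>
     within_bounds N lb ub \<pi>"

definition MT_objective ::
  "('v::finite) network \<Rightarrow> ('v \<Rightarrow> real) \<Rightarrow>
   real ^ 'v \<Rightarrow> ('v \<Rightarrow> 'v \<Rightarrow> real) \<Rightarrow> real ^ 'v \<Rightarrow> real" where
  "MT_objective N c x \<phi> \<pi> = (\<Sum>i \<in> UNIV. c i * injection N x i)"

definition EF_feasible ::
  "('v::finite) network \<Rightarrow> real ^ ('v \<times> 'v) \<Rightarrow> ('v \<Rightarrow> real) \<Rightarrow> ('v \<Rightarrow> real) \<Rightarrow>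
   real ^ 'v \<Rightarrow> real ^ 'v \<Rightarrow> bool" where
  "EF_feasible N b lb ub x \<pi> \<longleftrightarrow> energy_gap N \<pi> x b \<le> 0 \<and> within_bounds N lb ub \<pi>"

definition EF_objective ::
  "('v::finite) network \<Rightarrow> ('v \<Rightarrow> real) \<Rightarrow> real ^ 'v \<Rightarrow> real ^ 'v \<Rightarrow> real" where
  "EF_objective N c x \<pi> = (\<Sum>i \<in> UNIV. c i * injection N x i)"

definition twice_differentiable :: "('a::real_normed_vector \<Rightarrow> real) \<Rightarrow> bool" where
  "twice_differentiable h \<longleftrightarrow>
     (\<exists>D :: 'a \<Rightarrow> 'a \<Rightarrow>\<^sub>L real.
        (\<forall>z. (h has_derivative blinfun_apply (D z)) (at z)) \<and> (\<forall>z. D differentiable at z))"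

definition biconvex :: "('a::real_vector \<Rightarrow> 'b::real_vector \<Rightarrow> real) \<Rightarrow> bool" where
  "biconvex h \<longleftrightarrow>
     (\<forall>y. convex_on UNIV (\<lambda>x. h x y)) \<and> (\<forall>x. convex_on UNIV (\<lambda>y. h x y))"

lemma adiss_above_tangent:
  assumes "dissipative_network N" "(i, j) \<in> edges N"
  shows "adiss N i j t - adiss N i j s \<ge> diss N i j s * (t - s)"
proof -
  have d: "\<And>t. (adiss N i j has_real_derivative diss N i j t) (at t)" and m: "mono (diss N i j)"
    using assms by (auto simp: dissipative_network_def strict_mono_mono)
  have "convex_on UNIV (adiss N i j)"
    by (rule convex_on_realI[where f' = "diss N i j"]) (use d m in \<open>auto simp: mono_def\<close>)
  then show ?thesis
    by (rule convex_on_imp_above_tangent) (use d in auto)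
qed

lemma fenchel_young_edge:
  assumes "dissipative_network N" "(i, j) \<in> edges N"
  shows "t * y - edge_energy N i j y \<le> adiss N i j t"
proof -
  have "diss N i j (inv_diss N i j y) = y"
    using assms by (auto simp: dissipative_network_def inv_diss_def bij_def surj_f_inv_f)
  then show ?thesis
    using adiss_above_tangent[OF assms, of "inv_diss N i j y" t]
    by (simp add: edge_energy_def algebra_simps)
qed

lemma path_flow:
  assumes "(r, j) \<in> (A \<union> A\<inverse>)\<^sup>*" "finite A"
  shows "\<exists>\<theta>. \<forall>p :: 'v \<Rightarrow> real. p j - p r = (\<Sum>e\<in>A. \<theta> e * (p (fst e) - p (snd e)))"
  using assms(1)
proof (induction rule: rtrancl_induct)
  case base
  show ?case by (rule exI[of _ "\<lambda>_. 0"]) simp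
next
  case (step k l)
  then obtain \<theta> where \<theta>: "\<And>p :: 'v \<Rightarrow> real.
      p k - p r = (\<Sum>e\<in>A. \<theta> e * (p (fst e) - p (snd e)))" by blast
  have "\<exists>e0\<in>A. \<exists>s::real. \<forall>p :: 'v \<Rightarrow> real. p l - p k = s * (p (fst e0) - p (snd e0))"
  proof (cases "(k, l) \<in> A")
    case True
    then show ?thesis by (intro bexI[of _ "(k, l)"] exI[of _ "-1"]) auto
  next
    case False
    with step have "(l, k) \<in> A" by auto
    then show ?thesis by (intro bexI[of _ "(l, k)"] exI[of _ "1"]) auto
  qed
  then obtain e0 s where e0: "e0 \<in> A"
    and s: "\<And>p :: 'v \<Rightarrow> real. p l - p k = s * (p (fst e0) - p (snd e0))" by blast
  show ?case
  proof (intro exI allI)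
    fix p :: "'v \<Rightarrow> real"
    have "(\<Sum>e\<in>A. (\<theta> e + (if e = e0 then s else 0)) * (p (fst e) - p (snd e)))
        = (\<Sum>e\<in>A. \<theta> e * (p (fst e) - p (snd e)))
          + (\<Sum>e\<in>A. if e = e0 then s * (p (fst e) - p (snd e)) else 0)"
      unfolding sum.distrib[symmetric] by (rule sum.cong) (auto simp: distrib_right)
    also have "\<dots> = (p k - p r) + (p l - p k)"
      using assms(2) e0 by (simp add: \<theta> s sum.delta)
    finally show "p l - p r
        = (\<Sum>e\<in>A. (\<theta> e + (if e = e0 then s else 0)) * (p (fst e) - p (snd e)))" by simp
  qed
qed

lemma bdd_above_energy_conj:
  assumes "dissipative_network N"
  shows "bdd_above (range (\<lambda>\<pi>. pairing N \<pi> x - energy N \<pi> b))"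
proof -
  let ?V = "UNIV - {ref N}"
  have "\<forall>j. \<exists>\<theta>. \<forall>p :: 'a \<Rightarrow> real. p j - p (ref N)
      = (\<Sum>e\<in>edges N. \<theta> e * (p (fst e) - p (snd e)))"
    using assms by (intro allI path_flow) (auto simp: dissipative_network_def)
  then obtain \<theta> where \<theta>: "\<And>j (p :: 'a \<Rightarrow> real). p j - p (ref N)
      = (\<Sum>e\<in>edges N. \<theta> j e * (p (fst e) - p (snd e)))" by metis
  define t where "t e = (\<Sum>j\<in>?V. x $ j * \<theta> j e)" for e
  have pair: "pairing N \<pi> x = cref N * (\<Sum>j\<in>?V. x $ j)
      + (\<Sum>e\<in>edges N. t e * (potential N \<pi> (fst e) - potential N \<pi> (snd e)))" for \<pi>
  proof -
    have "pairing N \<pi> x - cref N * (\<Sum>j\<in>?V. x $ j)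
        = (\<Sum>j\<in>?V. x $ j * (potential N \<pi> j - potential N \<pi> (ref N)))"
      unfolding pairing_def sum_distrib_left sum_subtractf[symmetric]
      by (rule sum.cong) (auto simp: potential_def algebra_simps)
    also have "\<dots> = (\<Sum>j\<in>?V. \<Sum>e\<in>edges N.
        x $ j * \<theta> j e * (potential N \<pi> (fst e) - potential N \<pi> (snd e)))"
      by (simp only: \<theta> sum_distrib_left mult.assoc)
    also have "\<dots> = (\<Sum>e\<in>edges N. t e * (potential N \<pi> (fst e) - potential N \<pi> (snd e)))"
      unfolding t_def sum_distrib_right by (rule sum.swap)
    finally show ?thesis by simp
  qed
  show ?thesis
  proof (rule bdd_aboveI2)
    fix \<pi>
    let ?d = "\<lambda>e. potential N \<pi> (fst e) - potential N \<pi> (snd e)"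
    have "(\<Sum>e\<in>edges N. t e * ?d e) - energy N \<pi> b
        = (\<Sum>e\<in>edges N. t e * ?d e - edge_energy N (fst e) (snd e) (?d e + b $ e))"
      by (simp add: energy_def sum_subtractf case_prod_unfold)
    also have "\<dots> \<le> (\<Sum>e\<in>edges N. adiss N (fst e) (snd e) (t e) - t e * b $ e)"
    proof (rule sum_mono)
      fix e assume "e \<in> edges N"
      then show "t e * ?d e - edge_energy N (fst e) (snd e) (?d e + b $ e)
          \<le> adiss N (fst e) (snd e) (t e) - t e * b $ e"
        using fenchel_young_edge[OF assms, of "fst e" "snd e" "t e" "?d e + b $ e"]
        by (simp add: algebra_simps)
    qed
    finally show "pairing N \<pi> x - energy N \<pi> b \<le> cref N * (\<Sum>j\<in>?V. x $ j)
        + (\<Sum>e\<in>edges N. adiss N (fst e) (snd e) (t e) - t e * b $ e)"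
      by (simp add: pair)
  qed
qed

end

theory Submission
  imports Defs
begin

text \<open>The energy \<open>E\<close> is a sum over the edges of strictly convex functions of affine forms in
  \<open>(\<pi>, b)\<close>, and \<open>E\<^sup>*\<close> is its conjugate in \<open>\<pi>\<close>. By the Fenchel--Young inequality the gap
  \<open>E + E\<^sup>* - \<pi>\<^sup>T x\<close> is nonnegative, and it vanishes exactly when \<open>x\<close> is the gradient of
  \<open>E\<close> at \<open>\<pi>\<close>. The derivative of an edge energy is the inverse dissipation function, so this
  gradient is the net outflow of the flow that the potentials force through the edges; this is the
  equivalence of the two problems (\<open>EF_feasible_iff_MT_feasible\<close>).

  For twice differentiability the point is that the maximiser \<open>\<pi>\<close> in the definition of \<open>E\<^sup>*(x, b)\<close>
  exists, is unique and depends differentiably on \<open>(x, b)\<close>. Existence follows from coercivity,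
  which rests on the connectedness of the graph, and uniqueness from strict monotonicity of the
  gradient. Differentiability follows from an inverse function theorem
  (\<open>differentiable_argmax\<close>), since the Hessian of \<open>E\<close> in \<open>\<pi>\<close> is positive definite. By the
  envelope theorem the gradient of \<open>E\<^sup>*\<close> is then a differentiable function of the maximiser
  (\<open>twice_differentiable_conjugate\<close>). All of this is done for arbitrary sums of convex functions of
  affine forms, and a quadratic term in the dummy reference coordinate brings the network into
  that form.

  Convexity in \<open>\<pi>\<close> and in \<open>x\<close> is immediate: \<open>E\<close> is convex and \<open>E\<^sup>*\<close> is a supremum of affine
  functions. For variable \<open>b\<close> a single example refutes biconvexity for all three ways of joining
  \<open>b\<close> to the blocks of variables, because on a triangle with a cubic dissipation function the gap is
  not even convex in \<open>b\<close> alone (\<open>not_convex_in_parameters\<close>).\<close>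

section \<open>Twice differentiable functions\<close>

lemma twice_differentiableI:
  fixes h :: "'a::euclidean_space \<Rightarrow> real"
  assumes "\<And>z. (h has_derivative (\<lambda>w. grad z \<bullet> w)) (at z)"
    and "\<And>z. grad differentiable at z"
  shows "twice_differentiable h"
  unfolding twice_differentiable_def
proof (intro exI[of _ "\<lambda>z. blinfun_inner_right (grad z)"] conjI allI)
  fix z
  show "(h has_derivative blinfun_apply (blinfun_inner_right (grad z))) (at z)"
    using assms(1)[of z] by (simp add: blinfun_inner_right.rep_eq)
  show "(\<lambda>z. blinfun_inner_right (grad z)) differentiable at z"
    using assms(2)[of z] bounded_linear.has_derivative[OF bounded_linear_blinfun_inner_right]
    unfolding differentiable_def by blast
qed

lemma twice_differentiable_add:
  assumes "twice_differentiable h" "twice_differentiable k"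
  shows "twice_differentiable (\<lambda>z. h z + k z)"
proof -
  obtain D E where D: "\<And>z. (h has_derivative blinfun_apply (D z)) (at z)"
      "\<And>z. D differentiable at z"
    and E: "\<And>z. (k has_derivative blinfun_apply (E z)) (at z)" "\<And>z. E differentiable at z"
    using assms unfolding twice_differentiable_def by blast
  show ?thesis
    unfolding twice_differentiable_def
    by (rule exI[of _ "\<lambda>z. D z + E z"])
      (use D E in \<open>auto simp: plus_blinfun.rep_eq intro!: has_derivative_add differentiable_add\<close>)
qed

lemma twice_differentiable_compose_affine:
  fixes L :: "'a::real_normed_vector \<Rightarrow> 'b::real_normed_vector"
  assumes "twice_differentiable h" "bounded_linear L"
  shows "twice_differentiable (\<lambda>z. h (L z + a))"
proof -
  obtain D where D: "\<And>z. (h has_derivative blinfun_apply (D z)) (at z)"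
      "\<And>z. D differentiable at z"
    using assms unfolding twice_differentiable_def by blast
  have L: "((\<lambda>z. L z + a) has_derivative L) (at z)" for z
    by (auto intro!: derivative_eq_intros bounded_linear_imp_has_derivative assms)
  show ?thesis
    unfolding twice_differentiable_def
  proof (intro exI[of _ "\<lambda>z. D (L z + a) o\<^sub>L Blinfun L"] conjI allI)
    fix z
    show "((\<lambda>z. h (L z + a)) has_derivative blinfun_apply (D (L z + a) o\<^sub>L Blinfun L)) (at z)"
      using has_derivative_compose[OF L D(1)] assms(2)
      by (simp add: blinfun_compose.rep_eq bounded_linear_Blinfun_apply o_def)
    obtain D' where "(D has_derivative D') (at (L z + a))"
      using D(2) unfolding differentiable_def by blast
    from has_derivative_compose[OF L this]
    have "((\<lambda>z. D (L z + a) o\<^sub>L Blinfun L) has_derivative (\<lambda>w. D' (L w) o\<^sub>L Blinfun L)) (at z)"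
      by (rule bounded_linear.has_derivative[OF bounded_bilinear.bounded_linear_left
            [OF bounded_bilinear_blinfun_compose]])
    then show "(\<lambda>z. D (L z + a) o\<^sub>L Blinfun L) differentiable at z"
      by (rule differentiableI)
  qed
qed

section \<open>Sums of convex functions of affine forms\<close>

text \<open>The variable \<open>a\<close> and the parameter \<open>b\<close> enter only through finitely many affine forms.
  The bounds \<open>fenchel\<close>, with \<open>F k t\<close> finite for every \<open>t\<close>, say that each \<open>G k\<close> grows
  faster than any linear function; together with \<open>separating\<close> they make the sum coercive in
  \<open>a\<close>. The zeros of the gap are characterised from first derivatives alone; second
  derivatives enter only in the extension \<open>smooth_ridge_energy\<close>.\<close>

locale ridge_energy =
  fixes K :: "'k set"
    and G g F :: "'k \<Rightarrow> real \<Rightarrow> real"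
    and \<alpha> :: "'k \<Rightarrow> 'a::euclidean_space"
    and \<beta> :: "'k \<Rightarrow> 'b::euclidean_space"
    and c :: "'k \<Rightarrow> real"
  assumes finite_K: "finite K"
    and deriv_G: "k \<in> K \<Longrightarrow> (G k has_real_derivative g k s) (at s)"
    and strict_mono_g: "k \<in> K \<Longrightarrow> strict_mono (g k)"
    and fenchel: "k \<in> K \<Longrightarrow> t * s - G k s \<le> F k t"
    and separating: "(\<And>k. k \<in> K \<Longrightarrow> \<alpha> k \<bullet> u = 0) \<Longrightarrow> u = 0"
begin

definition arg :: "'k \<Rightarrow> 'a \<Rightarrow> 'b \<Rightarrow> real" where
  "arg k a b = \<alpha> k \<bullet> a + \<beta> k \<bullet> b + c k"

definition total :: "'a \<Rightarrow> 'b \<Rightarrow> real" where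
  "total a b = (\<Sum>k\<in>K. G k (arg k a b))"

definition grad :: "'a \<Rightarrow> 'b \<Rightarrow> 'a" where
  "grad a b = (\<Sum>k\<in>K. g k (arg k a b) *\<^sub>R \<alpha> k)"

definition pgrad :: "'a \<Rightarrow> 'b \<Rightarrow> 'b" where
  "pgrad a b = (\<Sum>k\<in>K. g k (arg k a b) *\<^sub>R \<beta> k)"

definition conjugate :: "'a \<Rightarrow> 'b \<Rightarrow> real" where
  "conjugate x b = (SUP a. a \<bullet> x - total a b)"

lemma has_derivative_arg:
  "((\<lambda>z. arg k (fst z) (snd z)) has_derivative (\<lambda>w. \<alpha> k \<bullet> fst w + \<beta> k \<bullet> snd w)) (at z)"
  unfolding arg_def by (auto intro!: derivative_eq_intros)

lemma has_derivative_total: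
  "((\<lambda>z. total (fst z) (snd z)) has_derivative
     (\<lambda>w. (grad (fst z) (snd z), pgrad (fst z) (snd z)) \<bullet> w)) (at z)"
proof -
  have "((\<lambda>z. total (fst z) (snd z)) has_derivative
      (\<lambda>w. \<Sum>k\<in>K. g k (arg k (fst z) (snd z)) * (\<alpha> k \<bullet> fst w + \<beta> k \<bullet> snd w))) (at z)"
    unfolding total_def
    by (intro has_derivative_sum has_derivative_compose[OF has_derivative_arg]
        deriv_G[unfolded has_field_derivative_def])
  then show ?thesis
    by (rule has_derivative_eq_rhs)
      (auto simp: grad_def pgrad_def inner_prod_def inner_sum_left sum.distrib algebra_simps
        intro!: sum.cong ext)
qed

text \<open>Convexity in \<open>a\<close>, in the form that turns every critical point of
  \<open>a \<bullet> x - total a b\<close> into a global maximiser.\<close>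
lemma tangent: "total a' b \<ge> total a b + grad a b \<bullet> (a' - a)"
proof -
  have "G k (arg k a' b) \<ge> G k (arg k a b) + g k (arg k a b) * (\<alpha> k \<bullet> (a' - a))" if k: "k \<in> K" for k
  proof -
    have "convex_on UNIV (G k)"
      by (rule convex_on_realI[where f' = "g k"])
        (use k deriv_G strict_mono_g in \<open>auto simp: strict_mono_less_eq\<close>)
    then have "G k (arg k a' b) - G k (arg k a b) \<ge> g k (arg k a b) * (arg k a' b - arg k a b)"
      by (rule convex_on_imp_above_tangent) (use deriv_G k in auto)
    then show ?thesis by (simp add: arg_def inner_diff_right)
  qed
  then have "total a' b \<ge> (\<Sum>k\<in>K. G k (arg k a b) + g k (arg k a b) * (\<alpha> k \<bullet> (a' - a)))"
    unfolding total_def by (intro sum_mono)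
  then show ?thesis by (simp add: total_def grad_def inner_sum_left sum.distrib)
qed

lemma conjugate_eq:
  assumes "grad a b = x"
  shows "conjugate x b = a \<bullet> x - total a b"
  unfolding conjugate_def
proof (rule cSup_eq_maximum)
  fix r assume "r \<in> range (\<lambda>a. a \<bullet> x - total a b)"
  then obtain a' where "r = a' \<bullet> x - total a' b" by auto
  then show "r \<le> a \<bullet> x - total a b"
    using tangent[of a b a'] assms by (simp add: inner_diff_right inner_commute)
qed auto

lemma maximiser_imp_grad_eq:
  assumes "\<And>a'. a' \<bullet> x - total a' b \<le> a \<bullet> x - total a b"
  shows "grad a b = x"
proof -
  have "((\<lambda>a. (a, b)) has_derivative (\<lambda>u. (u, 0))) (at a)"
    by (auto intro!: derivative_eq_intros)
  from has_derivative_compose[OF this has_derivative_total]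
  have "((\<lambda>a. total a b) has_derivative (\<lambda>u. grad a b \<bullet> u)) (at a)" by (simp add: inner_prod_def)
  then have "((\<lambda>a. a \<bullet> x - total a b) has_derivative (\<lambda>u. u \<bullet> x - grad a b \<bullet> u)) (at a)"
    by (auto intro!: derivative_eq_intros)
  then have "(\<lambda>u. u \<bullet> x - grad a b \<bullet> u) = (\<lambda>u. 0)"
    by (rule differential_zero_maxmin[OF UNIV_I open_UNIV]) (use assms in auto)
  then have "(x - grad a b) \<bullet> (x - grad a b) = 0"
    by (metis inner_commute inner_diff_left)
  then show ?thesis by simp
qed

text \<open>The function \<open>total a b - a \<bullet> x\<close> grows at least like \<open>norm a\<close>, hence attains
  its minimum on a ball outside of which it exceeds its value at \<open>0\<close>; there the gradient equals
  \<open>x\<close>.\<close>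
lemma grad_surj: "\<exists>a. grad a b = x"
proof -
  have lin: "linear (\<lambda>u. \<Sum>k\<in>K. (\<alpha> k \<bullet> u) *\<^sub>R \<alpha> k)"
    by (rule linearI) (simp_all add: inner_add_right scaleR_add_left sum.distrib scaleR_sum_right)
  have "inj (\<lambda>u. \<Sum>k\<in>K. (\<alpha> k \<bullet> u) *\<^sub>R \<alpha> k)"
    unfolding linear_injective_0[OF lin]
  proof (intro allI impI)
    fix u assume "(\<Sum>k\<in>K. (\<alpha> k \<bullet> u) *\<^sub>R \<alpha> k) = 0"
    then have "(\<Sum>k\<in>K. (\<alpha> k \<bullet> u) *\<^sub>R \<alpha> k) \<bullet> u = 0" by simp
    then have "(\<Sum>k\<in>K. (\<alpha> k \<bullet> u)\<^sup>2) = 0" by (simp add: inner_sum_left power2_eq_square)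
    then show "u = 0" by (intro separating) (simp add: sum_nonneg_eq_0_iff finite_K)
  qed
  then obtain B where B: "B > 0" "\<And>u. B * norm u \<le> norm (\<Sum>k\<in>K. (\<alpha> k \<bullet> u) *\<^sub>R \<alpha> k)"
    using linear_inj_bounded_below_pos[OF lin] by blast
  \<comment> \<open>The slope \<open>s\<close> beats the linear term by one: \<open>s * B * norm a - a \<bullet> x \<ge> norm a\<close>. It is
    weighted by \<open>norm (\<alpha> k)\<close> because \<open>B\<close> bounds the norm of the sum of \<open>(\<alpha> k \<bullet> a) *\<^sub>R \<alpha> k\<close>.\<close>
  define s where "s = (norm x + 1) / B"
  define t where "t k = s * norm (\<alpha> k)" for k
  define C where "C = (\<Sum>k\<in>K. max (F k (t k)) (F k (- t k)) + t k * \<bar>\<beta> k \<bullet> b + c k\<bar>)"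
  have s: "s > 0" "s * B = norm x + 1" unfolding s_def using B(1) by (auto simp: add_nonneg_pos)
  have coercive: "total a b - a \<bullet> x \<ge> norm a - C" for a
  proof -
    have "G k (arg k a b) \<ge> s * (\<bar>\<alpha> k \<bullet> a\<bar> * norm (\<alpha> k))
        - (max (F k (t k)) (F k (- t k)) + t k * \<bar>\<beta> k \<bullet> b + c k\<bar>)" if k: "k \<in> K" for k
    proof -
      have "t k * \<bar>arg k a b\<bar> - G k (arg k a b) \<le> max (F k (t k)) (F k (- t k))"
        using fenchel[OF k, of "t k" "arg k a b"] fenchel[OF k, of "- t k" "arg k a b"]
        by (auto simp: abs_if)
      moreover have "t k * (\<bar>\<alpha> k \<bullet> a\<bar> - \<bar>\<beta> k \<bullet> b + c k\<bar>) \<le> t k * \<bar>arg k a b\<bar>"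
        by (rule mult_left_mono) (use s in \<open>auto simp: arg_def t_def\<close>)
      ultimately show ?thesis by (simp add: t_def algebra_simps)
    qed
    then have "total a b \<ge> (\<Sum>k\<in>K. s * (\<bar>\<alpha> k \<bullet> a\<bar> * norm (\<alpha> k))
        - (max (F k (t k)) (F k (- t k)) + t k * \<bar>\<beta> k \<bullet> b + c k\<bar>))"
      unfolding total_def by (rule sum_mono)
    then have "total a b \<ge> s * (\<Sum>k\<in>K. norm ((\<alpha> k \<bullet> a) *\<^sub>R \<alpha> k)) - C"
      by (simp add: C_def sum_subtractf sum_distrib_left)
    moreover have "s * (B * norm a) \<le> s * (\<Sum>k\<in>K. norm ((\<alpha> k \<bullet> a) *\<^sub>R \<alpha> k))"
      using s(1) order_trans[OF B(2) norm_sum] by (intro mult_left_mono) auto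
    moreover have "s * (B * norm a) = norm x * norm a + norm a"
      by (metis s(2) distrib_right mult.assoc mult_1)
    moreover have "a \<bullet> x \<le> norm x * norm a"
      using norm_cauchy_schwarz[of a x] by (simp add: mult.commute)
    ultimately show ?thesis by linarith
  qed
  define R where "R = max 0 (C + total 0 b)"
  have "continuous_on UNIV (\<lambda>z. total (fst z) (snd z))"
    by (intro continuous_at_imp_continuous_on ballI has_derivative_continuous[OF has_derivative_total])
  then have "continuous_on (cball 0 R) (\<lambda>a. total (fst (a, b)) (snd (a, b)))"
    by (rule continuous_on_compose2) (auto intro!: continuous_intros)
  then have "continuous_on (cball 0 R) (\<lambda>a. total a b - a \<bullet> x)"
    by (auto intro!: continuous_intros)
  then obtain a where a: "a \<in> cball 0 R" "\<And>a'. a' \<in> cball 0 R \<Longrightarrow> total a b - a \<bullet> x \<le> total a' b - a' \<bullet> x"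
    using continuous_attains_inf[of "cball 0 R" "\<lambda>a. total a b - a \<bullet> x"] by (auto simp: R_def)
  have "total a b - a \<bullet> x \<le> total a' b - a' \<bullet> x" for a'
  proof (cases "a' \<in> cball 0 R")
    case False
    then have "norm a' > C + total 0 b" by (auto simp: R_def)
    then have "total a' b - a' \<bullet> x > total 0 b" using coercive[of a'] by linarith
    moreover have "total a b - a \<bullet> x \<le> total 0 b" using a(2)[of 0] by (simp add: R_def)
    ultimately show ?thesis by linarith
  qed (use a in auto)
  then show ?thesis using maximiser_imp_grad_eq[of x b a] by (auto simp: algebra_simps)
qed

text \<open>The equality case of the Fenchel--Young inequality.\<close>
lemma gap_le_0_iff: "total a b + conjugate x b - a \<bullet> x \<le> 0 \<longleftrightarrow> grad a b = x"
proof
  assume gap: "total a b + conjugate x b - a \<bullet> x \<le> 0"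
  obtain a0 where a0: "grad a0 b = x" using grad_surj by blast
  show "grad a b = x"
  proof (rule maximiser_imp_grad_eq)
    fix a'
    show "a' \<bullet> x - total a' b \<le> a \<bullet> x - total a b"
      using tangent[of a0 b a'] conjugate_eq[OF a0] gap a0 by (simp add: inner_diff_right inner_commute)
  qed
qed (simp add: conjugate_eq)

text \<open>The gradient is strictly monotone: each summand \<open>?m k\<close> of \<open>(grad a b - grad a' b) \<bullet> (a - a')\<close>
  is positive unless the two arguments agree.\<close>
lemma grad_inj:
  assumes "grad a b = grad a' b"
  shows "a = a'"
proof -
  let ?m = "\<lambda>k. (g k (arg k a b) - g k (arg k a' b)) * (arg k a b - arg k a' b)"
  have pos: "?m k \<ge> 0 \<and> (?m k = 0 \<longrightarrow> arg k a b = arg k a' b)" if "k \<in> K" for k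
    using strict_mono_less[OF strict_mono_g[OF that], of "arg k a b" "arg k a' b"]
      strict_mono_less[OF strict_mono_g[OF that], of "arg k a' b" "arg k a b"]
    by (cases "arg k a b" "arg k a' b" rule: linorder_cases)
       (auto simp: mult_nonpos_nonpos)
  have "(\<Sum>k\<in>K. ?m k) = (grad a b - grad a' b) \<bullet> (a - a')"
    by (simp add: grad_def arg_def inner_diff_left inner_diff_right inner_sum_left sum_subtractf
        algebra_simps sum.distrib)
  then have "(\<Sum>k\<in>K. ?m k) = 0" using assms by simp
  then have "\<forall>k\<in>K. ?m k = 0"
    using pos by (subst (asm) sum_nonneg_eq_0_iff) (auto simp: finite_K)
  then have "arg k a b = arg k a' b" if "k \<in> K" for k using pos that by blast
  then have "a - a' = 0"
    by (intro separating) (simp add: arg_def inner_diff_right)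
  then show ?thesis by simp
qed

end

locale smooth_ridge_energy = ridge_energy K G g F \<alpha> \<beta> c
  for K :: "'k set" and G g F
    and \<alpha> :: "'k \<Rightarrow> 'a::euclidean_space"
    and \<beta> :: "'k \<Rightarrow> 'b::euclidean_space"
    and c +
  fixes g' :: "'k \<Rightarrow> real \<Rightarrow> real"
  assumes deriv_g: "k \<in> K \<Longrightarrow> (g k has_real_derivative g' k s) (at s)"
    and g'_pos: "k \<in> K \<Longrightarrow> g' k s > 0"
begin

lemma has_derivative_g_arg:
  assumes "k \<in> K"
  shows "((\<lambda>z. g k (arg k (fst z) (snd z))) has_derivative
    (\<lambda>w. g' k (arg k (fst z) (snd z)) * (\<alpha> k \<bullet> fst w + \<beta> k \<bullet> snd w))) (at z)"
  by (rule has_derivative_compose[OF has_derivative_arg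
        deriv_g[OF assms, unfolded has_field_derivative_def]])

lemma has_derivative_grad:
  "((\<lambda>z. grad (fst z) (snd z)) has_derivative
    (\<lambda>w. \<Sum>k\<in>K. (g' k (arg k (fst z) (snd z)) * (\<alpha> k \<bullet> fst w + \<beta> k \<bullet> snd w)) *\<^sub>R \<alpha> k)) (at z)"
  unfolding grad_def
  by (intro has_derivative_sum has_derivative_scaleR_left has_derivative_g_arg)

lemma has_derivative_pgrad:
  "((\<lambda>z. pgrad (fst z) (snd z)) has_derivative
    (\<lambda>w. \<Sum>k\<in>K. (g' k (arg k (fst z) (snd z)) * (\<alpha> k \<bullet> fst w + \<beta> k \<bullet> snd w)) *\<^sub>R \<beta> k)) (at z)"
  unfolding pgrad_def
  by (intro has_derivative_sum has_derivative_scaleR_left has_derivative_g_arg)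

lemma twice_differentiable_total: "twice_differentiable (\<lambda>z. total (fst z) (snd z))"
proof (rule twice_differentiableI[OF has_derivative_total])
  show "(\<lambda>z. (grad (fst z) (snd z), pgrad (fst z) (snd z))) differentiable at z" for z
    by (rule differentiableI[OF has_derivative_Pair[OF has_derivative_grad has_derivative_pgrad]])
qed

definition argmax :: "'a \<times> 'b \<Rightarrow> 'a" where
  "argmax z = (SOME a. grad a (snd z) = fst z)"

lemma grad_argmax: "grad (argmax z) (snd z) = fst z"
  unfolding argmax_def by (rule someI_ex[OF grad_surj])

text \<open>The maximiser is the first component of the inverse of
  \<open>(a, b) \<mapsto> (grad a b, b)\<close>. That map is continuous and injective on the whole space, so an inverse
  function theorem based on invariance of domain applies: it needs the derivative to be invertible
  at a single point but not to depend continuously on the point. This matters since the \<open>g'\<close>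
  are not assumed continuous.\<close>
lemma differentiable_argmax: "argmax differentiable at z"
proof -
  let ?\<Phi> = "\<lambda>z. (grad (fst z) (snd z), snd z)" and ?\<Psi> = "\<lambda>z. (argmax z, snd z)"
  let ?a = "?\<Psi> z"
  define \<Phi>' where "\<Phi>' w = (\<Sum>k\<in>K. (g' k (arg k (fst ?a) (snd ?a)) *
      (\<alpha> k \<bullet> fst w + \<beta> k \<bullet> snd w)) *\<^sub>R \<alpha> k, snd w)" for w
  have deriv: "(?\<Phi> has_derivative \<Phi>') (at ?a)"
    unfolding \<Phi>'_def
    by (intro has_derivative_Pair has_derivative_grad derivative_intros)
  then have lin: "linear \<Phi>'" by (rule has_derivative_linear)
  have "inj \<Phi>'"
    unfolding linear_injective_0[OF lin]
  proof (intro allI impI)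
    \<comment> \<open>Pairing \<open>\<Phi>' w\<close> with \<open>fst w\<close> gives the Hessian quadratic form, a positive combination of squares.\<close>
    fix w assume "\<Phi>' w = 0"
    then have w: "snd w = 0"
      and "(\<Sum>k\<in>K. (g' k (arg k (fst ?a) (snd ?a)) * (\<alpha> k \<bullet> fst w)) *\<^sub>R \<alpha> k) \<bullet> fst w = 0"
      by (auto simp: \<Phi>'_def zero_prod_def)
    then have "(\<Sum>k\<in>K. g' k (arg k (fst ?a) (snd ?a)) * (\<alpha> k \<bullet> fst w)\<^sup>2) = 0"
      by (simp add: inner_sum_left power2_eq_square mult.assoc)
    then have "\<forall>k\<in>K. g' k (arg k (fst ?a) (snd ?a)) * (\<alpha> k \<bullet> fst w)\<^sup>2 = 0"
      by (subst (asm) sum_nonneg_eq_0_iff) (use g'_pos in \<open>auto simp: finite_K less_imp_le\<close>)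
    then have "fst w = 0"
      using g'_pos by (intro separating) (metis less_irrefl mult_eq_0_iff power_eq_0_iff)
    with w show "w = 0" by (simp add: prod_eq_iff)
  qed
  then obtain \<Psi>' where \<Psi>': "\<Phi>' \<circ> \<Psi>' = id"
    using linear_surjective_right_inverse[OF lin] linear_injective_imp_surjective[OF lin] by blast
  have "(?\<Psi> has_derivative \<Psi>') (at z)"
  proof (rule has_derivative_inverse_strong_x[where f = ?\<Phi> and g = ?\<Psi> and S = UNIV and f' = \<Phi>'])
    show "(?\<Phi> has_derivative \<Phi>') (at (?\<Psi> z))" by (rule deriv)
    show "\<Phi>' \<circ> \<Psi>' = id" by (rule \<Psi>')
    show "continuous_on UNIV ?\<Phi>"
      by (intro continuous_on_Pair continuous_at_imp_continuous_on ballI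
          has_derivative_continuous[OF has_derivative_grad] continuous_intros)
    show "?\<Psi> (?\<Phi> w) = w" for w
      using grad_argmax[of "?\<Phi> w"] by (auto simp: prod_eq_iff intro: grad_inj)
    show "?\<Phi> (?\<Psi> z) = z" by (simp add: grad_argmax)
  qed auto
  from has_derivative_fst[OF this] show ?thesis
    by (auto simp: differentiable_def)
qed

text \<open>The envelope theorem: as the maximiser is itself differentiable and critical, the terms
  containing its derivative cancel, and the gradient of the conjugate is the maximiser together with
  \<open>- pgrad\<close> evaluated there; both are differentiable.\<close>
lemma twice_differentiable_conjugate: "twice_differentiable (\<lambda>z. conjugate (fst z) (snd z))"
proof (rule twice_differentiableI[where grad = "\<lambda>z. (argmax z, - pgrad (argmax z) (snd z))"])
  fix z
  obtain A where A: "(argmax has_derivative A) (at z)"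
    using differentiable_argmax[of z] unfolding differentiable_def by blast
  then have pair: "((\<lambda>z. (argmax z, snd z)) has_derivative (\<lambda>w. (A w, snd w))) (at z)"
    by (auto intro!: derivative_intros)
  have "((\<lambda>z. argmax z \<bullet> fst z - total (argmax z) (snd z)) has_derivative
      (\<lambda>w. (argmax z \<bullet> fst w + A w \<bullet> fst z)
        - (grad (argmax z) (snd z) \<bullet> A w + pgrad (argmax z) (snd z) \<bullet> snd w))) (at z)"
    using has_derivative_compose[OF pair has_derivative_total]
    by (intro has_derivative_diff has_derivative_inner A has_derivative_fst has_derivative_ident)
      (simp add: inner_prod_def)
  then show "((\<lambda>z. conjugate (fst z) (snd z)) has_derivative
      (\<lambda>w. (argmax z, - pgrad (argmax z) (snd z)) \<bullet> w)) (at z)"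
    by (simp add: conjugate_eq[OF grad_argmax] grad_argmax inner_prod_def inner_commute algebra_simps)
  from has_derivative_Pair[OF A has_derivative_minus[OF has_derivative_compose[OF pair has_derivative_pgrad]]]
  show "(\<lambda>z. (argmax z, - pgrad (argmax z) (snd z))) differentiable at z"
    by (auto intro: differentiableI)
qed

end

section \<open>Flow balance\<close>

lemma neighbour_sum_eq:
  fixes N :: "('v::finite) network" and \<phi> :: "'v \<Rightarrow> 'v \<Rightarrow> real"
  assumes N: "dissipative_network N" and anti: "\<forall>(i, j) \<in> edges N. \<phi> j i = - \<phi> i j"
  shows "(\<Sum>j\<in>neighbours N i. \<phi> i j)
    = (\<Sum>(k, l)\<in>edges N. \<phi> k l * (of_bool (k = i) - of_bool (l = i)))"
proof -
  let ?out = "{j. (i, j) \<in> edges N}" and ?in = "{j. (j, i) \<in> edges N}"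
  have disj: "?out \<inter> ?in = {}" using N by (auto simp: dissipative_network_def)
  have "(\<Sum>j\<in>neighbours N i. \<phi> i j) = (\<Sum>j\<in>?out. \<phi> i j) + (\<Sum>j\<in>?in. \<phi> i j)"
    using disj by (simp add: neighbours_def Collect_disj_eq sum.union_disjoint)
  also have "(\<Sum>j\<in>?in. \<phi> i j) = - (\<Sum>j\<in>?in. \<phi> j i)"
    by (subst sum_negf[symmetric], rule sum.cong) (use anti in auto)
  also have "(\<Sum>j\<in>?out. \<phi> i j) = (\<Sum>(k, l)\<in>Pair i ` ?out. \<phi> k l)"
    by (simp add: sum.reindex inj_on_def)
  also have "\<dots> = (\<Sum>(k, l)\<in>edges N. \<phi> k l * of_bool (k = i))"
    by (rule sum.mono_neutral_cong_left) auto
  also have "(\<Sum>j\<in>?in. \<phi> j i) = (\<Sum>(k, l)\<in>(\<lambda>j. (j, i)) ` ?in. \<phi> k l)"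
    by (simp add: sum.reindex inj_on_def)
  also have "\<dots> = (\<Sum>(k, l)\<in>edges N. \<phi> k l * of_bool (l = i))"
    by (rule sum.mono_neutral_cong_left) auto
  finally show ?thesis
    by (simp add: right_diff_distrib sum_subtractf case_prod_unfold)
qed

text \<open>Summed over all nodes, every edge contributes its flow once with each sign, so balance at the
  reference node follows from balance elsewhere.\<close>
lemma balance_at_ref:
  fixes N :: "('v::finite) network"
  assumes "\<And>i. i \<noteq> ref N \<Longrightarrow>
    (\<Sum>(k, l)\<in>edges N. \<phi> k l * (of_bool (k = i) - of_bool (l = i))) = injection N x i"
  shows "(\<Sum>(k, l)\<in>edges N. \<phi> k l * (of_bool (k = i) - of_bool (l = i))) = injection N x i"
proof (cases "i = ref N")
  case True
  let ?s = "\<lambda>i. \<Sum>(k, l)\<in>edges N. \<phi> k l * (of_bool (k = i) - of_bool (l = i))"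
  have "(\<Sum>i\<in>UNIV. ?s i) = (\<Sum>(k, l)\<in>edges N. \<Sum>i\<in>UNIV. \<phi> k l * (of_bool (k = i) - of_bool (l = i)))"
    by (subst sum.swap) (simp add: case_prod_unfold)
  also have "\<dots> = 0"
    by (simp add: sum_distrib_left[symmetric] sum_subtractf of_bool_def)
  finally have "?s (ref N) = - (\<Sum>i\<in>UNIV - {ref N}. ?s i)"
    by (simp add: sum.remove[of UNIV "ref N"])
  also have "(\<Sum>i\<in>UNIV - {ref N}. ?s i) = (\<Sum>i\<in>UNIV - {ref N}. x $ i)"
    using assms by (intro sum.cong) (auto simp: injection_def)
  finally show ?thesis by (simp add: True injection_def)
qed (rule assms)

section \<open>The energy of a dissipative network\<close>

locale dissipative =
  fixes N :: "('v::finite) network"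
  assumes network: "dissipative_network N"
begin

lemma no_loop: "(i, i) \<notin> edges N"
  using network by (auto simp: dissipative_network_def)

lemma diss_inv_diss: "(i, j) \<in> edges N \<Longrightarrow> diss N i j (inv_diss N i j y) = y"
  using network by (auto simp: dissipative_network_def inv_diss_def bij_def surj_f_inv_f)

lemma inv_diss_diss: "(i, j) \<in> edges N \<Longrightarrow> inv_diss N i j (diss N i j t) = t"
  using network by (auto simp: dissipative_network_def inv_diss_def bij_def)

lemma strict_mono_inv_diss:
  assumes e: "(i, j) \<in> edges N"
  shows "strict_mono (inv_diss N i j)"
proof (rule strict_monoI)
  fix y z :: real assume "y < z"
  moreover have "strict_mono (diss N i j)"
    using network e by (auto simp: dissipative_network_def)
  ultimately show "inv_diss N i j y < inv_diss N i j z"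
    using diss_inv_diss[OF e] by (metis strict_mono_less)
qed

lemma isCont_inv_diss:
  assumes e: "(i, j) \<in> edges N"
  shows "isCont (inv_diss N i j) y"
proof -
  have "range (inv_diss N i j) = UNIV"
    using inv_diss_diss[OF e] by (metis surjI)
  then have "continuous_on UNIV (inv_diss N i j)"
    using strict_mono_inv_diss[OF e] by (intro continuous_onI_mono) (auto simp: strict_mono_less_eq)
  then show ?thesis by (simp add: continuous_on_eq_continuous_at)
qed

lemma edge_energy_subgradient:
  assumes e: "(i, j) \<in> edges N"
  shows "inv_diss N i j y * (z - y) \<le> edge_energy N i j z - edge_energy N i j y"
  using fenchel_young_edge[OF network e, of "inv_diss N i j y" z]
  by (simp add: edge_energy_def algebra_simps)

text \<open>The subgradient inequality, used in both directions, squeezes the difference quotient of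
  \<open>edge_energy\<close> between values of \<open>inv_diss\<close>, which is continuous. Going through the
  explicit formula instead would require \<open>inv_diss\<close> to be differentiable.\<close>
lemma edge_energy_deriv:
  assumes e: "(i, j) \<in> edges N"
  shows "(edge_energy N i j has_real_derivative inv_diss N i j y) (at y)"
proof -
  let ?g = "inv_diss N i j" and ?G = "edge_energy N i j"
  have "\<bar>(?G z - ?G y) / (z - y) - ?g y\<bar> \<le> \<bar>?g z - ?g y\<bar>" if "z \<noteq> y" for z
  proof -
    have "\<bar>?G z - ?G y - ?g y * (z - y)\<bar> \<le> (?g z - ?g y) * (z - y)"
      using edge_energy_subgradient[OF e, of y z] edge_energy_subgradient[OF e, of z y]
      by (simp add: algebra_simps)
    also have "\<dots> \<le> \<bar>?g z - ?g y\<bar> * \<bar>z - y\<bar>"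
      by (metis abs_ge_self abs_mult)
    finally have "\<bar>?G z - ?G y - ?g y * (z - y)\<bar> / \<bar>z - y\<bar> \<le> \<bar>?g z - ?g y\<bar>"
      using that by (simp add: pos_divide_le_eq)
    moreover have "(?G z - ?G y) / (z - y) - ?g y = (?G z - ?G y - ?g y * (z - y)) / (z - y)"
      using that by (simp add: field_simps)
    ultimately show ?thesis by (simp only: abs_divide)
  qed
  then have "\<forall>\<^sub>F z in at y. norm ((?G z - ?G y) / (z - y) - ?g y) \<le> norm (?g z - ?g y)"
    by (auto simp: eventually_at_filter)
  moreover have "((\<lambda>z. ?g z - ?g y) \<longlongrightarrow> 0) (at y)"
    using isCont_inv_diss[OF e, of y] by (simp add: isCont_def LIM_zero)
  ultimately have "((\<lambda>z. (?G z - ?G y) / (z - y) - ?g y) \<longlongrightarrow> 0) (at y)"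
    by (rule Lim_null_comparison[OF _ tendsto_norm_zero])
  then show ?thesis
    by (simp add: has_field_derivative_iff LIM_zero_iff)
qed

text \<open>The energy is constant in the coordinate of \<open>\<pi>\<close> at the reference node, hence
  not coercive on \<open>real ^ 'v\<close>, and \<open>pairing\<close> is not its full inner product. Both defects disappear
  after adding the term \<open>(\<pi> $ ref N)\<^sup>2 / 2\<close>. It is treated as one more edge, the loop at
  the reference node, which no dissipative network contains; the test \<open>fst e = snd e\<close> singles it out.\<close>

definition ground_G :: "'v \<times> 'v \<Rightarrow> real \<Rightarrow> real" where
  "ground_G e y = (if fst e = snd e then y\<^sup>2 / 2 else edge_energy N (fst e) (snd e) y)"

definition ground_g :: "'v \<times> 'v \<Rightarrow> real \<Rightarrow> real" where
  "ground_g e y = (if fst e = snd e then y else inv_diss N (fst e) (snd e) y)"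

definition ground_F :: "'v \<times> 'v \<Rightarrow> real \<Rightarrow> real" where
  "ground_F e t = (if fst e = snd e then t\<^sup>2 / 2 else adiss N (fst e) (snd e) t)"

definition unit_at :: "'v \<Rightarrow> real ^ 'v" where
  "unit_at i = (if i = ref N then 0 else axis i 1)"

definition ground_\<alpha> :: "'v \<times> 'v \<Rightarrow> real ^ 'v" where
  "ground_\<alpha> e = (if fst e = snd e then axis (fst e) 1 else unit_at (fst e) - unit_at (snd e))"

definition ground_\<beta> :: "'v \<times> 'v \<Rightarrow> real ^ ('v \<times> 'v)" where
  "ground_\<beta> e = (if fst e = snd e then 0 else axis e 1)"

definition ground_c :: "'v \<times> 'v \<Rightarrow> real" where
  "ground_c e = (if fst e = snd e then 0
     else cref N * (of_bool (fst e = ref N) - of_bool (snd e = ref N)))"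

sublocale ground: ridge_energy "insert (ref N, ref N) (edges N)"
  ground_G ground_g ground_F ground_\<alpha> ground_\<beta> ground_c
proof
  fix k :: "'v \<times> 'v" and s t :: real
  assume "k \<in> insert (ref N, ref N) (edges N)"
  then consider "k = (ref N, ref N)" | i j where "k = (i, j)" "(i, j) \<in> edges N" "i \<noteq> j"
    using no_loop by (cases k) fastforce
  note cs = this
  show "(ground_G k has_real_derivative ground_g k s) (at s)"
    using cs
    by cases (auto simp: ground_G_def[abs_def] ground_g_def edge_energy_deriv
        intro!: derivative_eq_intros)
  show "strict_mono (ground_g k)"
    using cs
    by cases (auto simp: ground_g_def[abs_def] strict_mono_inv_diss strict_mono_def[of "\<lambda>y. y"])
  have "t * s - s\<^sup>2 / 2 \<le> t\<^sup>2 / 2"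
    using zero_le_power2[of "t - s"] by (simp add: power2_diff algebra_simps)
  with cs show "t * s - ground_G k s \<le> ground_F k t"
    by cases (simp_all add: ground_G_def ground_F_def fenchel_young_edge[OF network])
next
  fix u :: "real ^ 'v"
  assume u: "\<And>k. k \<in> insert (ref N, ref N) (edges N) \<Longrightarrow> ground_\<alpha> k \<bullet> u = 0"
  have r: "u $ ref N = 0"
    using u[of "(ref N, ref N)"] by (simp add: ground_\<alpha>_def inner_axis')
  have "unit_at j \<bullet> u = 0" for j
  proof -
    have "(ref N, j) \<in> (edges N \<union> (edges N)\<inverse>)\<^sup>*"
      using network by (auto simp: dissipative_network_def)
    then obtain \<theta> where \<theta>: "\<And>p :: 'v \<Rightarrow> real. p j - p (ref N)
        = (\<Sum>e\<in>edges N. \<theta> e * (p (fst e) - p (snd e)))"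
      using path_flow[OF _ finite] by blast
    have "unit_at (fst e) \<bullet> u - unit_at (snd e) \<bullet> u = 0" if "e \<in> edges N" for e
      using u[of e] that by (cases "fst e = snd e") (auto simp: ground_\<alpha>_def inner_diff_left)
    then have "unit_at j \<bullet> u - unit_at (ref N) \<bullet> u = 0"
      by (subst \<theta>[of "\<lambda>i. unit_at i \<bullet> u"]) (simp add: sum.neutral)
    then show ?thesis by (simp add: unit_at_def)
  qed
  moreover have "unit_at j \<bullet> u = u $ j" if "j \<noteq> ref N" for j
    using that by (simp add: unit_at_def inner_axis')
  ultimately have "u $ j = 0" for j
    using r by metis
  then show "u = 0" by (simp add: vec_eq_iff)
qed simp

lemma unit_at_inner: "unit_at i \<bullet> \<pi> = potential N \<pi> i - cref N * of_bool (i = ref N)"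
  by (simp add: unit_at_def potential_def inner_axis')

lemma ground_arg:
  "ground.arg (i, j) \<pi> b =
    (if i = j then \<pi> $ i else potential N \<pi> i - potential N \<pi> j + b $ (i, j))"
  by (simp add: ground.arg_def ground_\<alpha>_def ground_\<beta>_def ground_c_def inner_diff_left
      unit_at_inner inner_axis' algebra_simps)

lemma ground_total: "ground.total \<pi> b = energy N \<pi> b + (\<pi> $ ref N)\<^sup>2 / 2"
proof -
  have "ground_G e (ground.arg e \<pi> b)
      = edge_energy N (fst e) (snd e) (potential N \<pi> (fst e) - potential N \<pi> (snd e) + b $ e)"
    if "e \<in> edges N" for e
    using that no_loop by (cases e) (auto simp: ground_arg ground_G_def)
  then show ?thesis
    using no_loop by (simp add: ground.total_def energy_def case_prod_unfold ground_arg)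
      (simp add: ground_G_def)
qed

lemma ground_grad:
  assumes "i \<noteq> ref N"
  shows "ground.grad \<pi> b $ i = (\<Sum>(k, l)\<in>edges N.
    inv_diss N k l (potential N \<pi> k - potential N \<pi> l + b $ (k, l))
      * (of_bool (k = i) - of_bool (l = i)))"
proof -
  have "ground_g e (ground.arg e \<pi> b) * ground_\<alpha> e $ i
      = (case e of (k, l) \<Rightarrow> inv_diss N k l (potential N \<pi> k - potential N \<pi> l + b $ (k, l))
          * (of_bool (k = i) - of_bool (l = i)))" if "e \<in> edges N" for e
    using that no_loop assms
    by (cases e) (auto simp: ground_arg ground_g_def ground_\<alpha>_def unit_at_def axis_def)
  then show ?thesis
    using no_loop assms
    by (simp add: ground.grad_def sum_component ground_\<alpha>_def[of "(ref N, ref N)"] axis_def)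
qed

lemma ground_grad_ref: "ground.grad \<pi> b $ ref N = \<pi> $ ref N"
proof -
  have "ground_\<alpha> e $ ref N = 0" if "e \<in> edges N" for e
    using that no_loop by (cases e) (auto simp: ground_\<alpha>_def unit_at_def axis_def)
  then show ?thesis
    using no_loop
    by (simp add: ground.grad_def sum_component ground_arg ground_g_def ground_\<alpha>_def axis_def)
qed

lemma inner_eq_pairing: "\<pi> \<bullet> x = pairing N \<pi> x + \<pi> $ ref N * x $ ref N"
  by (simp add: inner_vec_def pairing_def sum.remove[of UNIV "ref N"])

lemma ground_conjugate: "ground.conjugate x b = energy_conj N x b + (x $ ref N)\<^sup>2 / 2"
proof (rule antisym)
  have split: "a \<bullet> x - ground.total a b
      = pairing N a x - energy N a b + (a $ ref N * x $ ref N - (a $ ref N)\<^sup>2 / 2)" for a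
    by (simp add: inner_eq_pairing ground_total)
  have bound: "a \<bullet> x - ground.total a b \<le> energy_conj N x b + (x $ ref N)\<^sup>2 / 2" for a
  proof -
    have "pairing N a x - energy N a b \<le> energy_conj N x b"
      unfolding energy_conj_def by (rule cSUP_upper[OF UNIV_I bdd_above_energy_conj[OF network]])
    moreover have "a $ ref N * x $ ref N - (a $ ref N)\<^sup>2 / 2 \<le> (x $ ref N)\<^sup>2 / 2"
      using zero_le_power2[of "a $ ref N - x $ ref N"] by (simp add: power2_diff algebra_simps)
    ultimately show ?thesis unfolding split by linarith
  qed
  then show "ground.conjugate x b \<le> energy_conj N x b + (x $ ref N)\<^sup>2 / 2"
    unfolding ground.conjugate_def by (intro cSUP_least) auto
  have "pairing N a x - energy N a b \<le> ground.conjugate x b - (x $ ref N)\<^sup>2 / 2" for a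
  proof -
    define a' where "a' = (\<chi> i. if i = ref N then x $ ref N else a $ i)"
    have "pairing N a' x = pairing N a x" by (simp add: pairing_def a'_def)
    moreover have "potential N a' = potential N a" by (auto simp: potential_def a'_def)
    then have "energy N a' b = energy N a b" by (simp add: energy_def)
    moreover have "a' \<bullet> x - ground.total a' b \<le> ground.conjugate x b"
      unfolding ground.conjugate_def by (intro cSUP_upper bdd_aboveI2[OF bound] UNIV_I)
    ultimately show ?thesis unfolding split by (simp add: a'_def power2_eq_square)
  qed
  then have "energy_conj N x b \<le> ground.conjugate x b - (x $ ref N)\<^sup>2 / 2"
    unfolding energy_conj_def by (intro cSUP_least) auto
  then show "energy_conj N x b + (x $ ref N)\<^sup>2 / 2 \<le> ground.conjugate x b" by simp
qed

text \<open>The last term undoes the effect of the added loop on the energy and on its conjugate; it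
  vanishes when the two dummy coordinates agree.\<close>
lemma energy_gap_eq:
  "energy_gap N \<pi> x b
    = ground.total \<pi> b + ground.conjugate x b - \<pi> \<bullet> x - (\<pi> $ ref N - x $ ref N)\<^sup>2 / 2"
  unfolding energy_gap_def ground_total ground_conjugate inner_eq_pairing
  by (simp add: power2_diff field_simps)

text \<open>The gap ignores the dummy coordinate of \<open>x\<close>, which may therefore be changed to that of
  \<open>\<pi>\<close>.\<close>
lemma energy_gap_le_0_iff:
  "energy_gap N \<pi> x b \<le> 0 \<longleftrightarrow> (\<forall>i. i \<noteq> ref N \<longrightarrow> ground.grad \<pi> b $ i = x $ i)"
proof -
  define x' where "x' = (\<chi> i. if i = ref N then \<pi> $ ref N else x $ i)"
  have "pairing N a x' = pairing N a x" for a by (simp add: pairing_def x'_def)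
  then have "energy_gap N \<pi> x b = energy_gap N \<pi> x' b"
    by (simp add: energy_gap_def energy_conj_def)
  moreover have "energy_gap N \<pi> x' b = ground.total \<pi> b + ground.conjugate x' b - \<pi> \<bullet> x'"
    unfolding energy_gap_eq by (simp add: x'_def)
  ultimately have "energy_gap N \<pi> x b \<le> 0 \<longleftrightarrow> ground.grad \<pi> b = x'"
    using ground.gap_le_0_iff[of \<pi> b x'] by simp
  also have "\<dots> \<longleftrightarrow> (\<forall>i. i \<noteq> ref N \<longrightarrow> ground.grad \<pi> b $ i = x $ i)"
    by (auto simp: vec_eq_iff x'_def ground_grad_ref)
  finally show ?thesis .
qed

text \<open>The dissipation law determines the flow on every edge as \<open>inv_diss\<close> of the potential
  drop shifted by \<open>b\<close>, and the gradient of the energy with respect to a potential is the net outflow of this flow.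
  So vanishing of the gap says precisely that this flow is balanced by \<open>x\<close>.\<close>
lemma EF_feasible_iff_MT_feasible:
  "EF_feasible N b lb ub x \<pi> \<longleftrightarrow> (\<exists>\<phi>. MT_feasible N b lb ub x \<phi> \<pi>)"
proof -
  let ?y = "\<lambda>i j. potential N \<pi> i - potential N \<pi> j + b $ (i, j)"
  let ?net = "\<lambda>\<phi> i. \<Sum>(k, l)\<in>edges N. \<phi> k l * (of_bool (k = i) - of_bool (l = i))"
  have gap: "energy_gap N \<pi> x b \<le> 0 \<longleftrightarrow>
      (\<forall>i. i \<noteq> ref N \<longrightarrow> ?net (\<lambda>k l. inv_diss N k l (?y k l)) i = injection N x i)"
    by (simp add: energy_gap_le_0_iff ground_grad injection_def)
  show ?thesis
  proof
    assume EF: "EF_feasible N b lb ub x \<pi>"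
    define \<phi> where "\<phi> i j = (if (i, j) \<in> edges N then inv_diss N i j (?y i j)
        else - inv_diss N j i (?y j i))" for i j
    have edge: "\<phi> i j = inv_diss N i j (?y i j)" if "(i, j) \<in> edges N" for i j
      using that by (simp add: \<phi>_def)
    have anti: "\<forall>(i, j)\<in>edges N. \<phi> j i = - \<phi> i j"
      using network by (auto simp: \<phi>_def dissipative_network_def)
    have "?net \<phi> i = ?net (\<lambda>k l. inv_diss N k l (?y k l)) i" for i
      by (rule sum.cong) (auto simp: edge)
    moreover have "energy_gap N \<pi> x b \<le> 0" using EF by (simp add: EF_feasible_def)
    ultimately have "?net \<phi> i = injection N x i" if "i \<noteq> ref N" for i
      using that unfolding gap by simp
    then have "?net \<phi> i = injection N x i" for i
      by (rule balance_at_ref)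
    moreover have "potential N \<pi> i - potential N \<pi> j = diss N i j (\<phi> i j) - b $ (i, j)"
      if "(i, j) \<in> edges N" for i j
      using that by (simp add: edge diss_inv_diss)
    moreover have "within_bounds N lb ub \<pi>" using EF by (simp add: EF_feasible_def)
    ultimately have "MT_feasible N b lb ub x \<phi> \<pi>"
      unfolding MT_feasible_def neighbour_sum_eq[OF network anti]
      by (intro conjI anti allI) auto
    then show "\<exists>\<phi>. MT_feasible N b lb ub x \<phi> \<pi>" by blast
  next
    assume "\<exists>\<phi>. MT_feasible N b lb ub x \<phi> \<pi>"
    then obtain \<phi> where MT: "MT_feasible N b lb ub x \<phi> \<pi>" ..
    then have anti: "\<forall>(i, j)\<in>edges N. \<phi> j i = - \<phi> i j"
      and balance: "\<And>i. (\<Sum>j\<in>neighbours N i. \<phi> i j) = injection N x i"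
      and drop: "\<And>i j. (i, j) \<in> edges N \<Longrightarrow> ?y i j = diss N i j (\<phi> i j)"
      by (auto simp: MT_feasible_def)
    have "?net \<phi> i = ?net (\<lambda>k l. inv_diss N k l (?y k l)) i" for i
      by (rule sum.cong) (auto simp: drop inv_diss_diss)
    then have "energy_gap N \<pi> x b \<le> 0"
      using balance unfolding gap neighbour_sum_eq[OF network anti] by simp
    with MT show "EF_feasible N b lb ub x \<pi>" by (simp add: EF_feasible_def MT_feasible_def)
  qed
qed

lemma convex_on_energy: "convex_on UNIV (\<lambda>\<pi>. energy N \<pi> b)"
proof (rule convex_onI)
  fix t :: real and p q :: "real ^ 'v"
  assume t: "0 < t" "t < 1"
  let ?y = "\<lambda>\<pi> e. potential N \<pi> (fst e) - potential N \<pi> (snd e) + b $ e"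
  have pot: "potential N ((1 - t) *\<^sub>R p + t *\<^sub>R q) i
      = (1 - t) * potential N p i + t * potential N q i" for i
    by (simp add: potential_def algebra_simps)
  have "edge_energy N (fst e) (snd e) (?y ((1 - t) *\<^sub>R p + t *\<^sub>R q) e)
      \<le> (1 - t) * edge_energy N (fst e) (snd e) (?y p e)
        + t * edge_energy N (fst e) (snd e) (?y q e)" if "e \<in> edges N" for e
  proof -
    have "convex_on UNIV (edge_energy N (fst e) (snd e))"
      by (rule convex_on_realI[where f' = "inv_diss N (fst e) (snd e)"])
        (use that edge_energy_deriv strict_mono_inv_diss in \<open>auto simp: strict_mono_less_eq\<close>)
    moreover have "?y ((1 - t) *\<^sub>R p + t *\<^sub>R q) e = (1 - t) *\<^sub>R ?y p e + t *\<^sub>R ?y q e"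
      unfolding pot real_scaleR_def by (simp add: algebra_simps)
    ultimately show ?thesis
      using convex_onD[of UNIV _ t "?y p e" "?y q e"] t by simp
  qed
  then show "energy N ((1 - t) *\<^sub>R p + t *\<^sub>R q) b \<le> (1 - t) * energy N p b + t * energy N q b"
    unfolding energy_def case_prod_unfold sum_distrib_left sum.distrib[symmetric] prod.collapse
    by (rule sum_mono)
qed simp

lemma convex_on_energy_conj: "convex_on UNIV (\<lambda>x. energy_conj N x b)"
proof (rule convex_onI)
  fix t :: real and x y :: "real ^ 'v"
  assume t: "0 < t" "t < 1"
  have "pairing N \<pi> ((1 - t) *\<^sub>R x + t *\<^sub>R y) - energy N \<pi> b
      \<le> (1 - t) * energy_conj N x b + t * energy_conj N y b" for \<pi>
  proof -
    have le: "pairing N \<pi> x - energy N \<pi> b \<le> energy_conj N x b" for x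
      unfolding energy_conj_def by (rule cSUP_upper[OF UNIV_I bdd_above_energy_conj[OF network]])
    have "pairing N \<pi> ((1 - t) *\<^sub>R x + t *\<^sub>R y) = (1 - t) * pairing N \<pi> x + t * pairing N \<pi> y"
      by (simp add: pairing_def sum_distrib_left sum.distrib[symmetric] algebra_simps)
    then have "pairing N \<pi> ((1 - t) *\<^sub>R x + t *\<^sub>R y) - energy N \<pi> b
        = (1 - t) * (pairing N \<pi> x - energy N \<pi> b) + t * (pairing N \<pi> y - energy N \<pi> b)"
      by (simp add: algebra_simps)
    also have "\<dots> \<le> (1 - t) * energy_conj N x b + t * energy_conj N y b"
      using t le by (intro add_mono mult_left_mono) auto
    finally show ?thesis .
  qed
  then show "energy_conj N ((1 - t) *\<^sub>R x + t *\<^sub>R y) b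
      \<le> (1 - t) * energy_conj N x b + t * energy_conj N y b"
    unfolding energy_conj_def[of N "(1 - t) *\<^sub>R x + t *\<^sub>R y"] by (intro cSUP_least) auto
qed simp

lemma biconvex_energy_gap: "biconvex (\<lambda>\<pi> x. energy_gap N \<pi> x b)"
proof -
  have pair_l: "convex_on UNIV (\<lambda>\<pi>. energy_conj N x b - pairing N \<pi> x)" for x
    by (rule convex_onI)
      (auto simp: pairing_def sum_distrib_left sum.distrib[symmetric] sum_subtractf algebra_simps)
  have pair_r: "convex_on UNIV (\<lambda>x. energy N \<pi> b - pairing N \<pi> x)" for \<pi>
    by (rule convex_onI)
      (auto simp: pairing_def sum_distrib_left sum.distrib[symmetric] sum_subtractf algebra_simps)
  show ?thesis
    unfolding biconvex_def energy_gap_def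
    using convex_on_add[OF convex_on_energy pair_l] convex_on_add[OF convex_on_energy_conj pair_r]
    by (simp add: algebra_simps)
qed

end

section \<open>Twice differentiability of the energy gap\<close>

locale nondegenerate_dissipative = dissipative +
  assumes nondegenerate: "nondegenerate N"
begin

definition ground_g' :: "'a \<times> 'a \<Rightarrow> real \<Rightarrow> real" where
  "ground_g' e y = (if fst e = snd e then 1
     else inverse (deriv (diss N (fst e) (snd e)) (inv_diss N (fst e) (snd e) y)))"

lemma deriv_diss:
  assumes e: "(i, j) \<in> edges N"
  shows "(diss N i j has_real_derivative deriv (diss N i j) t) (at t)"
    and "deriv (diss N i j) t > 0"
proof -
  show d: "(diss N i j has_real_derivative deriv (diss N i j) t) (at t)" for t
    using network e
    by (auto simp: dissipative_network_def DERIV_deriv_iff_real_differentiable)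
  have "mono_on UNIV (diss N i j)"
    using network e by (auto simp: dissipative_network_def strict_mono_mono)
  then have "deriv (diss N i j) t \<ge> 0"
    by (rule mono_on_imp_deriv_nonneg[OF _ d]) auto
  then show "deriv (diss N i j) t > 0"
    using nondegenerate e by (auto simp: nondegenerate_def less_le)
qed

sublocale ground: smooth_ridge_energy "insert (ref N, ref N) (edges N)"
  ground_G ground_g ground_F ground_\<alpha> ground_\<beta> ground_c ground_g'
proof
  fix k :: "'a \<times> 'a" and s :: real
  assume "k \<in> insert (ref N, ref N) (edges N)"
  then consider "k = (ref N, ref N)" | i j where "k = (i, j)" "(i, j) \<in> edges N" "i \<noteq> j"
    using no_loop by (cases k) fastforce
  note cs = this
  have "(inv_diss N i j has_real_derivative
      inverse (deriv (diss N i j) (inv_diss N i j s))) (at s)" if e: "(i, j) \<in> edges N" for i j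
    by (rule DERIV_inverse_function[where f = "diss N i j" and a = "s - 1" and b = "s + 1"])
      (use deriv_diss[OF e] diss_inv_diss[OF e] isCont_inv_diss[OF e] in \<open>auto simp: less_le\<close>)
  with cs show "(ground_g k has_real_derivative ground_g' k s) (at s)"
    by cases (auto simp: ground_g_def[abs_def] ground_g'_def)
  show "ground_g' k s > 0"
    using cs by cases (auto simp: ground_g'_def deriv_diss)
qed

lemma twice_differentiable_energy_gap:
  "twice_differentiable (\<lambda>(\<pi>, x, b). energy_gap N \<pi> x b)"
proof -
  define e :: "real ^ 'a" where "e = axis (ref N) 1"
  have ref: "v $ ref N = v \<bullet> e" for v by (simp add: e_def inner_axis)
  have 1: "twice_differentiable (\<lambda>z :: (real ^ 'a) \<times> (real ^ 'a) \<times> (real ^ ('a \<times> 'a)).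
      ground.total (fst z) (snd (snd z)))"
    using twice_differentiable_compose_affine[OF ground.twice_differentiable_total,
        of "\<lambda>z. (fst z, snd (snd z))" 0]
    by (simp add: bounded_linear_intros)
  have 2: "twice_differentiable (\<lambda>z :: (real ^ 'a) \<times> (real ^ 'a) \<times> (real ^ ('a \<times> 'a)).
      ground.conjugate (fst (snd z)) (snd (snd z)))"
    using twice_differentiable_compose_affine[OF ground.twice_differentiable_conjugate,
        of snd 0]
    by (simp add: bounded_linear_intros)
  define D :: "(real ^ 'a) \<times> (real ^ 'a) \<times> (real ^ ('a \<times> 'a)) \<Rightarrow>
      (real ^ 'a) \<times> (real ^ 'a) \<times> (real ^ ('a \<times> 'a))" where
    "D z = (- fst (snd z) - ((fst z - fst (snd z)) \<bullet> e) *\<^sub>R e,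
      - fst z + ((fst z - fst (snd z)) \<bullet> e) *\<^sub>R e, 0)" for z
  have 3: "twice_differentiable (\<lambda>z :: (real ^ 'a) \<times> (real ^ 'a) \<times> (real ^ ('a \<times> 'a)).
      - (fst z \<bullet> fst (snd z)) - ((fst z - fst (snd z)) \<bullet> e)\<^sup>2 / 2)"
  proof (rule twice_differentiableI)
    fix z :: "(real ^ 'a) \<times> (real ^ 'a) \<times> (real ^ ('a \<times> 'a))"
    show "((\<lambda>z :: (real ^ 'a) \<times> (real ^ 'a) \<times> (real ^ ('a \<times> 'a)).
        - (fst z \<bullet> fst (snd z)) - ((fst z - fst (snd z)) \<bullet> e)\<^sup>2 / 2)
        has_derivative (\<lambda>w. D z \<bullet> w)) (at z)"
      by (auto intro!: derivative_eq_intros ext simp: D_def inner_prod_def inner_diff_left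
          inner_add_left inner_diff_right inner_add_right inner_commute field_simps)
    have "(D has_derivative D) (at z)"
      unfolding D_def by (auto intro!: derivative_eq_intros)
    then show "D differentiable at z"
      by (rule differentiableI)
  qed
  show ?thesis
    using twice_differentiable_add[OF twice_differentiable_add[OF 1 2] 3]
    by (simp add: energy_gap_eq case_prod_unfold ref inner_diff_left algebra_simps)
qed

end

section \<open>Loss of biconvexity when the parameters vary\<close>

text \<open>On a tree the conjugate is affine in \<open>b\<close>, so the gap is convex in \<open>b\<close>; and for
  linear dissipation the gap is half the squared (weighted) norm of an affine function of all
  variables. A gap that is not convex in \<open>b\<close> thus needs a cycle and a nonlinear dissipation
  function. For the cubic chosen here, \<open>edge_energy\<close> is an explicit polynomial in the flow.\<close>

definition cubic_cycle :: "3 network" where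
  "cubic_cycle = \<lparr>ref = 1, cref = 0, edges = {(1, 2), (2, 3), (3, 1)},
     diss = \<lambda>_ _ t. t + t ^ 3, adiss = \<lambda>_ _ t. t\<^sup>2 / 2 + t ^ 4 / 4\<rparr>"

lemma strict_mono_cubic: "strict_mono (\<lambda>t :: real. t + t ^ 3)"
  by (intro strict_monoI add_less_le_mono power_mono_odd) auto

lemma bij_cubic: "bij (\<lambda>t :: real. t + t ^ 3)"
proof (rule bijI)
  show "inj (\<lambda>t :: real. t + t ^ 3)"
    by (rule strict_mono_imp_inj_on[OF strict_mono_cubic])
  have "\<exists>t. t + t ^ 3 = y" for y :: real
  proof -
    have "\<exists>t\<ge>- \<bar>y\<bar>. t \<le> \<bar>y\<bar> \<and> t + t ^ 3 = y"
    proof (rule IVT')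
      have "\<bar>y\<bar> ^ 3 \<ge> 0" "(- \<bar>y\<bar>) ^ 3 = - (\<bar>y\<bar> ^ 3)" by simp_all
      then show "- \<bar>y\<bar> + (- \<bar>y\<bar>) ^ 3 \<le> y" "y \<le> \<bar>y\<bar> + \<bar>y\<bar> ^ 3" by linarith+
    qed (auto intro!: continuous_intros)
    then show ?thesis by blast
  qed
  then show "surj (\<lambda>t :: real. t + t ^ 3)" unfolding surj_def by metis
qed

lemma deriv_cubic: "((\<lambda>t :: real. t + t ^ 3) has_real_derivative 1 + 3 * t\<^sup>2) (at t)"
  by (auto intro!: derivative_eq_intros)

lemma dissipative_cubic_cycle: "dissipative_network cubic_cycle"
proof -
  let ?R = "{(1, 2), (2, 3), (3, 1)} \<union> {(1, 2), (2, 3), (3, 1)}\<inverse> :: (3 \<times> 3) set"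
  have "(1, j) \<in> ?R\<^sup>*" "(j, 1) \<in> ?R\<^sup>*" for j
    using exhaust_3[of j] by auto
  then have conn: "(i, j) \<in> ?R\<^sup>*" for i j
    by (blast intro: rtrancl_trans)
  have quartic: "((\<lambda>t :: real. t\<^sup>2 / 2 + t ^ 4 / 4) has_real_derivative t + t ^ 3) (at t)" for t
    by (auto intro!: derivative_eq_intros)
  have "(\<lambda>t :: real. t + t ^ 3) differentiable at t" for t
    using deriv_cubic real_differentiable_def by blast
  then show ?thesis
    unfolding dissipative_network_def cubic_cycle_def
    using conn quartic bij_cubic strict_mono_cubic by auto
qed

lemma nondegenerate_cubic_cycle: "nondegenerate cubic_cycle"
proof -
  have "deriv (\<lambda>t :: real. t + t ^ 3) t \<noteq> 0" for t
  proof -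
    have "(0 :: real) < 1 + 3 * t\<^sup>2" by (simp add: add_pos_nonneg)
    then show ?thesis using DERIV_imp_deriv[OF deriv_cubic] by simp
  qed
  then show ?thesis by (auto simp: nondegenerate_def cubic_cycle_def)
qed

lemma edge_energy_cubic: "edge_energy cubic_cycle i j (t + t ^ 3) = t\<^sup>2 / 2 + 3 / 4 * t ^ 4"
proof -
  have "inv_diss cubic_cycle i j (t + t ^ 3) = t"
    using inv_f_f[OF bij_is_inj[OF bij_cubic], of t] by (simp add: inv_diss_def cubic_cycle_def)
  then show ?thesis
    by (simp add: edge_energy_def cubic_cycle_def algebra_simps power2_eq_square power4_eq_xxxx
        power3_eq_cube)
qed

text \<open>Put the same parameter \<open>s\<close> on all three edges and inject nothing. By convexity the
  supremum in the conjugate is attained at equal potentials, so the conjugate is \<open>-3 * G s\<close>. The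
  potentials \<open>0, -2, 0\<close> give edge arguments \<open>2 + s, -2 + s, s\<close>. The curvature of \<open>G\<close>, which is
  the derivative of the inverse of \<open>t + t ^ 3\<close>, is largest at \<open>0\<close>; therefore
  \<open>G (2 + s) + G (s - 2) - 2 * G s\<close> has a strict local maximum at \<open>s = 0\<close>. Comparing
  \<open>s = 0\<close> with \<open>s = 2\<close> and \<open>s = -2\<close> suffices.\<close>
lemma not_convex_in_parameters:
  "\<not> convex_on UNIV (energy_gap cubic_cycle (\<chi> i. if i = 2 then -2 else 0) 0)"
proof
  interpret dissipative cubic_cycle
    by unfold_locales (rule dissipative_cubic_cycle)
  let ?N = cubic_cycle and ?\<pi> = "(\<chi> i. if i = 2 then -2 else 0) :: real ^ 3"
  let ?G = "edge_energy ?N 1 2"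
  define b :: "real \<Rightarrow> real ^ (3 \<times> 3)" where "b s = (\<chi> e. s)" for s
  have G_eq: "edge_energy ?N i j = ?G" for i j
    by (simp add: edge_energy_def[abs_def] inv_diss_def cubic_cycle_def)
  have energy: "energy ?N \<pi> (b s) = ?G (potential ?N \<pi> 1 - potential ?N \<pi> 2 + s)
      + ?G (potential ?N \<pi> 2 - potential ?N \<pi> 3 + s)
      + ?G (potential ?N \<pi> 3 - potential ?N \<pi> 1 + s)" for \<pi> s
  proof -
    have "edges ?N = {(1, 2), (2, 3), (3, 1)}" by (simp add: cubic_cycle_def)
    then show ?thesis
      by (simp add: energy_def b_def G_eq[of 2 3] G_eq[of 3 1])
  qed
  have pot: "potential ?N ?\<pi> 1 = 0" "potential ?N ?\<pi> 2 = -2" "potential ?N ?\<pi> 3 = 0"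
    "potential ?N 0 i = 0" for i
    by (auto simp: potential_def cubic_cycle_def)
  have G: "?G 0 = 0" "?G 2 = 5 / 4" "?G (-2) = 5 / 4"
    using edge_energy_cubic[of 1 2 0] edge_energy_cubic[of 1 2 1] edge_energy_cubic[of 1 2 "-1"]
    by auto
  have G4: "?G 4 < 5" "?G (-4) < 5"
  proof -
    obtain t :: real where t: "t + t ^ 3 = 4"
      using surjD[OF bij_is_surj[OF bij_cubic], of 4] by auto
    have "\<not> t \<ge> 3 / 2"
    proof
      assume "t \<ge> 3 / 2"
      then have "t ^ 3 \<ge> (3 / 2) ^ 3" by (intro power_mono) auto
      with t \<open>t \<ge> 3 / 2\<close> show False by (simp add: power_divide)
    qed
    moreover have "t \<ge> 0"
      using t strict_mono_less_eq[OF strict_mono_cubic, of 0 t] by simp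
    ultimately have "t\<^sup>2 \<le> (3 / 2)\<^sup>2" "t ^ 4 \<le> (3 / 2) ^ 4" by (auto intro!: power_mono simp del: power_divide)
    then have "t\<^sup>2 / 2 + 3 / 4 * t ^ 4 < 5" by (simp add: power_divide)
    moreover have neg: "- t + (- t) ^ 3 = - 4" using t by simp
    ultimately show "?G 4 < 5" "?G (-4) < 5"
      using edge_energy_cubic[of 1 2 t, unfolded t] edge_energy_cubic[of 1 2 "- t", unfolded neg]
      by auto
  qed
  have pairing: "pairing ?N \<pi> 0 = 0" for \<pi> by (simp add: pairing_def)
  have mid: "energy_gap ?N ?\<pi> 0 (b 0) \<ge> 5 / 2"
  proof -
    have "pairing ?N 0 0 - energy ?N 0 (b 0) \<le> energy_conj ?N 0 (b 0)"
      unfolding energy_conj_def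
      by (rule cSUP_upper[OF UNIV_I bdd_above_energy_conj[OF dissipative_cubic_cycle]])
    then show ?thesis by (simp add: energy_gap_def energy pot pairing G)
  qed
  \<comment> \<open>On this cycle the circulation \<open>s / 2\<close> solves \<open>t + t ^ 3 = s\<close> for \<open>s = 2\<close> and \<open>s = -2\<close>;
    the Fenchel--Young bounds at it add up because the potential drops cancel around the cycle.\<close>
  have conj: "energy_conj ?N 0 (b s) \<le> - 15 / 4" if s: "s = 2 \<or> s = -2" for s
  proof -
    have "energy ?N \<pi> (b s) \<ge> 15 / 4" for \<pi>
    proof -
      let ?p = "potential ?N \<pi>"
      have "s / 2 * y - 3 / 4 \<le> ?G y" for y
        using fenchel_young_edge[OF dissipative_cubic_cycle, of 1 2 "s / 2" y] s
        by (auto simp: cubic_cycle_def)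
      from this[of "?p 1 - ?p 2 + s"] this[of "?p 2 - ?p 3 + s"] this[of "?p 3 - ?p 1 + s"]
      show ?thesis
        unfolding energy using s by (elim disjE) simp_all
    qed
    then show ?thesis
      unfolding energy_conj_def by (intro cSUP_least) (auto simp: pairing)
  qed
  have ends: "energy_gap ?N ?\<pi> 0 (b 2) < 5 / 2" "energy_gap ?N ?\<pi> 0 (b (-2)) < 5 / 2"
    using conj[of 2] conj[of "-2"] G4 by (auto simp: energy_gap_def energy pot pairing G)
  assume "convex_on UNIV (energy_gap ?N ?\<pi> 0)"
  from convex_onD[OF this, of "1 / 2" "b 2" "b (-2)"]
  have "energy_gap ?N ?\<pi> 0 ((1 / 2) *\<^sub>R b 2 + (1 / 2) *\<^sub>R b (-2))
      \<le> (energy_gap ?N ?\<pi> 0 (b 2) + energy_gap ?N ?\<pi> 0 (b (-2))) / 2"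
    by (simp add: field_simps)
  also have "(1 / 2) *\<^sub>R b 2 + (1 / 2) *\<^sub>R b (-2) = b 0"
    by (simp add: b_def vec_eq_iff)
  finally show False using mid ends by simp
qed

lemma convex_on_section:
  assumes "convex_on UNIV (\<lambda>(a, b). f a b)"
  shows "convex_on UNIV (f a)"
proof (rule convex_onI)
  fix t :: real and x y
  assume "0 < t" "t < 1"
  then show "f a ((1 - t) *\<^sub>R x + t *\<^sub>R y) \<le> (1 - t) * f a x + t * f a y"
    using convex_onD[OF assms, of t "(a, x)" "(a, y)"] by (simp add: scaleR_collapse)
qed simp

section \<open>The equivalence and regularity theorem\<close>

theorem mainTheorem4:
  fixes N :: "('v::finite) network"
    and b :: "real ^ ('v \<times> 'v)"
    and c lb ub :: "'v \<Rightarrow> real"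
  assumes "dissipative_network N"
    and "\<And>i. lb i \<le> ub i"
  shows
    "((\<forall>x \<pi>. EF_feasible N b lb ub x \<pi> \<longleftrightarrow> (\<exists>\<phi>. MT_feasible N b lb ub x \<phi> \<pi>)) \<and>
      (\<forall>x \<phi> \<pi>. MT_objective N c x \<phi> \<pi> = EF_objective N c x \<pi>)) \<and>
     (nondegenerate N \<longrightarrow> twice_differentiable (\<lambda>(\<pi>, x). energy_gap N \<pi> x b)) \<and>
     (biconvex (\<lambda>\<pi> x. energy_gap N \<pi> x b) \<and>
      (nondegenerate N \<longrightarrow> twice_differentiable (\<lambda>(\<pi>, x, b). energy_gap N \<pi> x b)) \<and>
      (\<exists>N' :: 3 network. dissipative_network N' \<and> nondegenerate N' \<and>
        \<not> biconvex (\<lambda>(\<pi>, b) x. energy_gap N' \<pi> x b) \<and>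
        \<not> biconvex (\<lambda>\<pi> (x, b). energy_gap N' \<pi> x b) \<and>
        \<not> biconvex (\<lambda>(\<pi>, x) b. energy_gap N' \<pi> x b)))"
proof -
  interpret dissipative N
    by unfold_locales (rule assms)
  have joint: "twice_differentiable (\<lambda>(\<pi>, x, b). energy_gap N \<pi> x b)" if "nondegenerate N"
  proof -
    interpret nondegenerate_dissipative N
      by unfold_locales (rule that)
    show ?thesis by (rule twice_differentiable_energy_gap)
  qed
  have fixed_b: "twice_differentiable (\<lambda>(\<pi>, x). energy_gap N \<pi> x b)" if "nondegenerate N"
  proof -
    have "bounded_linear (\<lambda>z :: (real ^ 'v) \<times> (real ^ 'v). (fst z, snd z, 0 :: real ^ ('v \<times> 'v)))"
      by (intro bounded_linear_Pair bounded_linear_fst bounded_linear_snd bounded_linear_zero)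
    from twice_differentiable_compose_affine[OF joint[OF that] this, of "(0, 0, b)"]
    show ?thesis by (simp add: case_prod_unfold)
  qed
  let ?N = cubic_cycle and ?\<pi> = "(\<chi> i. if i = 2 then -2 else 0) :: real ^ 3"
  have "\<not> biconvex (\<lambda>(\<pi>, b) x. energy_gap ?N \<pi> x b)"
  proof
    assume "biconvex (\<lambda>(\<pi>, b) x. energy_gap ?N \<pi> x b)"
    then have "convex_on UNIV (\<lambda>(\<pi>, b). energy_gap ?N \<pi> 0 b)"
      by (simp add: biconvex_def case_prod_unfold)
    from convex_on_section[OF this] show False
      using not_convex_in_parameters by blast
  qed
  moreover have "\<not> biconvex (\<lambda>\<pi> (x, b). energy_gap ?N \<pi> x b)"
  proof
    assume "biconvex (\<lambda>\<pi> (x, b). energy_gap ?N \<pi> x b)"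
    then have "convex_on UNIV (\<lambda>(x, b). energy_gap ?N ?\<pi> x b)"
      by (simp add: biconvex_def)
    from convex_on_section[OF this] show False
      using not_convex_in_parameters by blast
  qed
  moreover have "\<not> biconvex (\<lambda>(\<pi>, x) b. energy_gap ?N \<pi> x b)"
  proof
    assume "biconvex (\<lambda>(\<pi>, x) b. energy_gap ?N \<pi> x b)"
    then have "convex_on UNIV ((\<lambda>(\<pi>, x) b. energy_gap ?N \<pi> x b) (?\<pi>, 0))"
      unfolding biconvex_def by blast
    then show False using not_convex_in_parameters by simp
  qed
  ultimately show ?thesis
    using EF_feasible_iff_MT_feasible biconvex_energy_gap joint fixed_b
      dissipative_cubic_cycle nondegenerate_cubic_cycle
    by (simp add: MT_objective_def EF_objective_def) blast
qed

end
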